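(* Let $P,Q\in\mathbb{R}^{d\times n}$ have columns $p^{(i)},q^{(i)}\in\mathbb{R}^d$, $i=1,\dots,n$, let $R_0\in O(d)$ and $I\subseteq\{1,\dots,n\}$, and suppose that $P,Q$ satisfy the linear dominance-of-inliers property (linear DIP) with respect to $(R_0,I)$. Then for any $p\in[1,\infty]$, the unique global minimizer of $\mathrm{E}_p(A)$ over $A\in\mathbb{R}^{d\times d}$ is $R_0$.
   Context: $\|\cdot\|$ is the Euclidean norm, $O(d)$ the set of $d\times d$ real orthogonal matrices, $I^C=\{1,\dots,n\}\setminus I$. $P,Q$ satisfy the linear DIP with respect to $(R_0,I)$ if $q^{(i)}=R_0p^{(i)}$ for all $i\in I$, and for every unit vector $u\in\mathbb{R}^d$, $$\sum_{i\in I}|\langle u,p^{(i)}\rangle|>\sum_{i\in I^C}|\langle u,p^{(i)}\rangle|\quad\text{and}\quad \sum_{i\in I}|\langle u,q^{(i)}\rangle|>\sum_{i\in I^C}|\langle u,q^{(i)}\rangle|.$$ For $A\in\mathbb{R}^{d\times d}$ and $1\le p<\infty$, $$\mathrm{E}_p(A)=\sum_{i=1}^n\left(\frac{\|Ap^{(i)}-q^{(i)}\|^p+\|A^Tq^{(i)}-p^{(i)}\|^p}{2}\right)^{1/p},$$ and $\mathrm{E}_\infty(A)=\sum_{i=1}^n\max\{\|Ap^{(i)}-q^{(i)}\|,\|A^Tq^{(i)}-p^{(i)}\|\}$. *)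

theory Defs
  imports "HOL-Analysis.Analysis"
begin

text \<open>
  A matrix in $R^{d \times n}$ has type \<open>real^'n^'d\<close>; its \<open>i\<close>-th column \<open>column i P\<close> has type
  \<open>real^'d\<close>. The index set $\{1,\dots,n\}$ is the type \<open>'n\<close>, so the complement of \<open>I\<close> is \<open>- I\<close>.
\<close>

definition linear_DIP ::
  "real^'n::finite^'d::finite \<Rightarrow> real^'n^'d \<Rightarrow> real^'d^'d \<Rightarrow> 'n set \<Rightarrow> bool" where
  "linear_DIP P Q R0 I \<longleftrightarrow>
     (\<forall>i\<in>I. column i Q = R0 *v column i P) \<and>
     (\<forall>u::real^'d. norm u = 1 \<longrightarrow>
        (\<Sum>i\<in>I. \<bar>u \<bullet> column i P\<bar>) > (\<Sum>i\<in>- I. \<bar>u \<bullet> column i P\<bar>) \<and>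
        (\<Sum>i\<in>I. \<bar>u \<bullet> column i Q\<bar>) > (\<Sum>i\<in>- I. \<bar>u \<bullet> column i Q\<bar>))"

text \<open>
  The exponent is an extended real; \<open>E_energy\<close> is only meaningful for $1 \le p \le \infty$.
\<close>

definition E_energy ::
  "real^'n::finite^'d::finite \<Rightarrow> real^'n^'d \<Rightarrow> ereal \<Rightarrow> real^'d^'d \<Rightarrow> real" where
  "E_energy P Q p A =
     (if p = \<infinity> then
        (\<Sum>i\<in>UNIV. max (norm (A *v column i P - column i Q))
                      (norm (transpose A *v column i Q - column i P)))
      else
        (\<Sum>i\<in>UNIV. ((norm (A *v column i P - column i Q) powr real_of_ereal p
                     + norm (transpose A *v column i Q - column i P) powr real_of_ereal p) / 2)
                    powr (1 / real_of_ereal p)))"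

end

theory Submission
  imports Defs "HOL-Probability.Probability"
begin

text \<open>
  By the power mean inequality \<open>E_energy P Q p A \<ge> E_energy P Q 1 A\<close>, with equality at the orthogonal
  matrix \<open>R0\<close>, where the two residuals of each index have equal norms; hence the case \<open>p = 1\<close>
  suffices. There the triangle inequality on the outliers reduces the claim to
  \<open>(\<Sum>i\<in>-I. norm (M *v column i P)) < (\<Sum>i\<in>I. norm (M *v column i P))\<close> for \<open>M = A - R0\<close>, and to its
  analogue for \<open>transpose M\<close> and \<open>Q\<close>. For a standard Gaussian vector \<open>g\<close>, \<open>norm (M *v x)\<close> is
  proportional to the mean of \<open>\<bar>(g v* M) \<bullet> x\<bar>\<close>, so this follows by averaging the dominance
  condition over the directions \<open>g v* M\<close>.
\<close>

text \<open>The standard Gaussian law as a product measure on functions, so that independence of the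
  coordinates comes from the product; \<open>\<chi> k. g k\<close> turns a sample into a
  vector.\<close>

definition gaussian_vec :: "('k \<Rightarrow> real) measure" where
  "gaussian_vec = PiM UNIV (\<lambda>_. density lborel (\<lambda>x. ennreal (std_normal_density x)))"

lemma prob_space_gaussian_vec: "prob_space gaussian_vec"
  unfolding gaussian_vec_def
  by (intro prob_space_PiM prob_space_normal_density) simp

lemma distr_gaussian_vec_component:
  "distr gaussian_vec borel (\<lambda>g. g k) = density lborel (\<lambda>x. ennreal (std_normal_density x))"
proof -
  have "distr gaussian_vec (density lborel (\<lambda>x. ennreal (std_normal_density x))) (\<lambda>g. g k)
      = density lborel (\<lambda>x. ennreal (std_normal_density x))"
    unfolding gaussian_vec_def
    by (rule distr_PiM_component) (auto intro: prob_space_normal_density)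
  moreover have "distr gaussian_vec borel (\<lambda>g. g k)
      = distr gaussian_vec (density lborel (\<lambda>x. ennreal (std_normal_density x))) (\<lambda>g. g k)"
    by (rule distr_cong) auto
  ultimately show ?thesis by simp
qed

lemma measurable_gaussian_vec_component [measurable]:
  "(\<lambda>g. g k) \<in> borel_measurable gaussian_vec"
proof -
  have "(\<lambda>g. g k) \<in> gaussian_vec \<rightarrow>\<^sub>M density lborel (\<lambda>x. ennreal (std_normal_density x))"
    unfolding gaussian_vec_def by (rule measurable_component_singleton) simp
  then show ?thesis by simp
qed

lemma indep_gaussian_vec:
  "prob_space.indep_vars gaussian_vec (\<lambda>_. borel) (\<lambda>k g. g k) UNIV"
proof -
  interpret prob_space gaussian_vec by (rule prob_space_gaussian_vec)
  have "distr gaussian_vec (PiM UNIV (\<lambda>_. borel)) (\<lambda>g. g) = distr gaussian_vec gaussian_vec (\<lambda>g. g)"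
    by (rule distr_cong) (auto simp: gaussian_vec_def intro!: sets_PiM_cong)
  then show ?thesis
    by (subst indep_vars_iff_distr_eq_PiM)
      (simp_all add: restrict_def distr_gaussian_vec_component flip: gaussian_vec_def)
qed

text \<open>The inner product is a sum of independent centred normals with deviations
  \<open>\<bar>x $ k\<bar>\<close>, hence normal with deviation \<open>norm x\<close>; its first
  absolute moment is that deviation times \<open>sqrt (2 / pi)\<close>.\<close>

lemma has_integral_abs_inner_gaussian:
  fixes x :: "real^'k"
  shows "has_bochner_integral gaussian_vec (\<lambda>g. \<bar>(\<chi> k. g k) \<bullet> x\<bar>) (norm x * sqrt (2 / pi))"
proof (cases "x = 0")
  case True
  then show ?thesis by (simp add: has_bochner_integral_zero)
next
  case False
  interpret prob_space "gaussian_vec :: ('k \<Rightarrow> real) measure" by (rule prob_space_gaussian_vec)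
  \<comment> \<open>A normal density needs positive deviation, so coordinates where \<open>x\<close>
    vanishes are dropped; they contribute nothing to the sums.\<close>
  define K where "K = {k. x $ k \<noteq> 0}"
  have sum_K: "(\<Sum>k\<in>K. f k) = (\<Sum>k\<in>UNIV. f k)" if "\<And>k. x $ k = 0 \<Longrightarrow> f k = 0" for f :: "'k \<Rightarrow> real"
    by (rule sum.mono_neutral_left) (auto simp: K_def that)
  have "K \<noteq> {}" using False by (auto simp: K_def vec_eq_iff)
  have normal: "distributed gaussian_vec lborel (\<lambda>g. g k * x $ k) (normal_density 0 \<bar>x $ k\<bar>)"
    if "k \<in> K" for k
  proof -
    have "distributed gaussian_vec lborel (\<lambda>g. g k) std_normal_density"
      unfolding distributed_def using distr_gaussian_vec_component[of k]
      by (auto simp: distr_cong[of _ _ lborel borel])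
    from normal_density_affine[OF this, of "x $ k" 0] that show ?thesis
      by (simp add: K_def mult.commute)
  qed
  have "distributed gaussian_vec lborel (\<lambda>g. \<Sum>k\<in>K. g k * x $ k)
      (normal_density (\<Sum>k\<in>K. 0) (sqrt (\<Sum>k\<in>K. \<bar>x $ k\<bar>\<^sup>2)))"
  proof (rule sum_indep_normal)
    show "indep_vars (\<lambda>_. borel) (\<lambda>k g. g k * x $ k) K"
      by (rule indep_vars_compose2[where Y = "\<lambda>k t. t * x $ k",
            OF indep_vars_subset[OF indep_gaussian_vec]]) auto
  qed (use \<open>K \<noteq> {}\<close> normal in \<open>auto simp: K_def\<close>)
  also have "(\<lambda>g. \<Sum>k\<in>K. g k * x $ k) = (\<lambda>g. (\<chi> k. g k) \<bullet> x)"
    by (simp add: inner_vec_def sum_K)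
  also have "sqrt (\<Sum>k\<in>K. \<bar>x $ k\<bar>\<^sup>2) = norm x"
    by (simp add: norm_vec_def L2_set_def sum_K)
  finally have D: "distributed gaussian_vec lborel (\<lambda>g. (\<chi> k. g k) \<bullet> x) (normal_density 0 (norm x))"
    by simp
  \<comment> \<open>The absolute moment of order \<open>2 * k + 1\<close> at
    \<open>k = 0\<close>.\<close>
  have "has_bochner_integral lborel (\<lambda>t. normal_density 0 (norm x) t * \<bar>t\<bar>) (norm x * sqrt (2 / pi))"
    using normal_moment_abs_odd[where \<mu> = 0 and \<sigma> = "norm x" and k = 0] False by simp
  with distributed_integrable[OF D, of abs] distributed_integral[OF D, of abs] show ?thesis
    by (simp add: has_bochner_integral_iff)
qed

text \<open>The margin \<open>c\<close> keeps the averaged inequality strict without any null-set argument.\<close>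

lemma dominance_quantitative:
  fixes p :: "'n::finite \<Rightarrow> real^'d"
  assumes "\<And>u. norm u = 1 \<Longrightarrow> (\<Sum>i\<in>-I. \<bar>u \<bullet> p i\<bar>) < (\<Sum>i\<in>I. \<bar>u \<bullet> p i\<bar>)"
  obtains c where "c > 0" "\<And>u. (\<Sum>i\<in>-I. \<bar>u \<bullet> p i\<bar>) + c * norm u \<le> (\<Sum>i\<in>I. \<bar>u \<bullet> p i\<bar>)"
proof -
  define F where "F u = (\<Sum>i\<in>I. \<bar>u \<bullet> p i\<bar>) - (\<Sum>i\<in>-I. \<bar>u \<bullet> p i\<bar>)" for u
  \<comment> \<open>The margin is the minimum of \<open>F\<close> over the compact unit sphere;
    homogeneity of \<open>F\<close> then carries the bound to all vectors.\<close>
  have "\<exists>v\<in>sphere 0 1. \<forall>u\<in>sphere 0 1. F v \<le> F u"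
    by (rule continuous_attains_inf) (auto simp: F_def intro!: continuous_intros)
  then obtain v where v: "norm v = 1" "\<And>u. norm u = 1 \<Longrightarrow> F v \<le> F u" by auto
  have F_scale: "F (t *\<^sub>R u) = \<bar>t\<bar> * F u" for t u
    by (simp add: F_def right_diff_distrib sum_distrib_left abs_mult)
  have "F v * norm u \<le> F u" for u
  proof (cases "u = 0")
    case True
    then show ?thesis by (simp add: F_def)
  next
    case False
    have "F v * norm u \<le> F (u /\<^sub>R norm u) * norm u"
      using False by (intro mult_right_mono v) auto
    also have "\<dots> = F u"
      using False F_scale[of "inverse (norm u)" u] by simp
    finally show ?thesis .
  qed
  moreover have "F v > 0" using assms[OF v(1)] by (simp add: F_def)
  ultimately show thesis by (intro that[of "F v"]) (auto simp: F_def algebra_simps)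
qed

lemma dominance_matrix:
  fixes p :: "'n::finite \<Rightarrow> real^'d" and M :: "real^'d^'m"
  assumes "\<And>u. norm u = 1 \<Longrightarrow> (\<Sum>i\<in>-I. \<bar>u \<bullet> p i\<bar>) < (\<Sum>i\<in>I. \<bar>u \<bullet> p i\<bar>)"
    and "M \<noteq> 0"
  shows "(\<Sum>i\<in>-I. norm (M *v p i)) < (\<Sum>i\<in>I. norm (M *v p i))"
proof -
  obtain c where c: "c > 0"
    "\<And>u. (\<Sum>i\<in>-I. \<bar>u \<bullet> p i\<bar>) + c * norm u \<le> (\<Sum>i\<in>I. \<bar>u \<bullet> p i\<bar>)"
    using dominance_quantitative[OF assms(1)] by blast
  \<comment> \<open>By Cauchy-Schwarz the margin \<open>c * norm u\<close> is at least
    \<open>c * \<bar>u \<bullet> a\<bar>\<close>. Unlike the norm, this term has a mean given by the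
    Gaussian formula, and the mean is positive because \<open>M *v a \<noteq> 0\<close>.\<close>
  obtain a where a: "M *v a \<noteq> 0" "norm a = 1"
  proof -
    from \<open>M \<noteq> 0\<close> obtain i j where "M $ i $ j \<noteq> 0" by (auto simp: vec_eq_iff)
    then have "M *v axis j 1 \<noteq> 0" by (auto simp: matrix_vector_mult_basis column_def vec_eq_iff)
    then show thesis by (intro that) auto
  qed
  let ?s = "sqrt (2 / pi)"
  have avg: "has_bochner_integral gaussian_vec (\<lambda>g. \<bar>((\<chi> k. g k) v* M) \<bullet> y\<bar>) (norm (M *v y) * ?s)" for y
    using has_integral_abs_inner_gaussian[of "M *v y"] by (simp add: dot_lmul_matrix)
  let ?w = "\<lambda>g. (\<chi> k. g k) v* M"
  have lower: "has_bochner_integral gaussian_vec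
      (\<lambda>g. (\<Sum>i\<in>-I. \<bar>?w g \<bullet> p i\<bar>) + c * \<bar>?w g \<bullet> a\<bar>)
      ((\<Sum>i\<in>-I. norm (M *v p i) * ?s) + c * (norm (M *v a) * ?s))"
    by (intro has_bochner_integral_add has_bochner_integral_sum has_bochner_integral_mult_right avg)
  have upper: "has_bochner_integral gaussian_vec (\<lambda>g. \<Sum>i\<in>I. \<bar>?w g \<bullet> p i\<bar>)
      (\<Sum>i\<in>I. norm (M *v p i) * ?s)"
    by (intro has_bochner_integral_sum avg)
  have pointwise: "(\<Sum>i\<in>-I. \<bar>?w g \<bullet> p i\<bar>) + c * \<bar>?w g \<bullet> a\<bar> \<le> (\<Sum>i\<in>I. \<bar>?w g \<bullet> p i\<bar>)" for g
  proof -
    have "\<bar>?w g \<bullet> a\<bar> \<le> norm (?w g)"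
      using Cauchy_Schwarz_ineq2[of "?w g" a] a by simp
    then have "c * \<bar>?w g \<bullet> a\<bar> \<le> c * norm (?w g)"
      using c(1) by simp
    then show ?thesis using c(2)[of "?w g"] by linarith
  qed
  have "(\<Sum>i\<in>-I. norm (M *v p i) * ?s) + c * (norm (M *v a) * ?s) \<le> (\<Sum>i\<in>I. norm (M *v p i) * ?s)"
    using integral_mono[OF integrable.intros[OF lower] integrable.intros[OF upper] pointwise]
    unfolding has_bochner_integral_integral_eq[OF lower] has_bochner_integral_integral_eq[OF upper] .
  moreover have "c * (norm (M *v a) * ?s) > 0" using a c(1) by simp
  ultimately have "(\<Sum>i\<in>-I. norm (M *v p i)) * ?s < (\<Sum>i\<in>I. norm (M *v p i)) * ?s"
    by (simp add: sum_distrib_right)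
  then show ?thesis by (simp add: mult_less_cancel_right)
qed

text \<open>At \<open>R\<close> the inliers cost nothing, while at \<open>A\<close> they cost
  \<open>norm ((A - R) *v p i)\<close>. On the outliers, passing from \<open>R\<close> to
  \<open>A\<close> gains at most the same expression, and dominance for \<open>A - R\<close> makes
  the total gain smaller than the cost.\<close>

lemma sum_norm_residual_less:
  fixes p :: "'n::finite \<Rightarrow> real^'d" and q :: "'n \<Rightarrow> real^'m" and A R :: "real^'d^'m"
  assumes dom: "\<And>u. norm u = 1 \<Longrightarrow> (\<Sum>i\<in>-I. \<bar>u \<bullet> p i\<bar>) < (\<Sum>i\<in>I. \<bar>u \<bullet> p i\<bar>)"
    and inliers: "\<And>i. i \<in> I \<Longrightarrow> q i = R *v p i"
    and "A \<noteq> R"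
  shows "(\<Sum>i\<in>UNIV. norm (R *v p i - q i)) < (\<Sum>i\<in>UNIV. norm (A *v p i - q i))"
proof -
  have split: "(\<Sum>i\<in>UNIV. f i) = (\<Sum>i\<in>I. f i) + (\<Sum>i\<in>-I. f i)" for f :: "'n \<Rightarrow> real"
    by (subst sum.union_disjoint[symmetric]) auto
  have "(\<Sum>i\<in>UNIV. norm (R *v p i - q i)) = (\<Sum>i\<in>-I. norm (R *v p i - q i))"
    by (simp add: split inliers)
  also have "\<dots> \<le> (\<Sum>i\<in>-I. norm (A *v p i - q i) + norm ((A - R) *v p i))"
  proof (rule sum_mono)
    fix i
    have "R *v p i - q i = (A *v p i - q i) - (A - R) *v p i"
      by (simp add: matrix_vector_mult_diff_rdistrib)
    then show "norm (R *v p i - q i) \<le> norm (A *v p i - q i) + norm ((A - R) *v p i)"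
      by (metis norm_triangle_ineq4)
  qed
  also have "\<dots> < (\<Sum>i\<in>-I. norm (A *v p i - q i)) + (\<Sum>i\<in>I. norm ((A - R) *v p i))"
    using dominance_matrix[OF dom, of "A - R"] \<open>A \<noteq> R\<close> by (simp add: sum.distrib)
  also have "\<dots> = (\<Sum>i\<in>UNIV. norm (A *v p i - q i))"
    by (simp add: split inliers matrix_vector_mult_diff_rdistrib)
  finally show ?thesis .
qed

text \<open>Midpoint convexity of \<open>t powr r\<close>, followed by the \<open>r\<close>-th
  root.\<close>

lemma arith_mean_le_power_mean:
  fixes a b r :: real
  assumes "0 \<le> a" "0 \<le> b" "1 \<le> r"
  shows "(a + b) / 2 \<le> ((a powr r + b powr r) / 2) powr (1 / r)"
proof -
  have half: "(1/2) powr r \<le> (1/2::real)"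
    using powr_mono'[of 1 r "1/2::real"] assms by simp
  have "((a + b) / 2) powr r \<le> (a powr r + b powr r) / 2"
  \<comment> \<open>Convexity is applied to positive arguments only; if one argument is zero, the
    claim reduces to \<open>half\<close>.\<close>
  proof (cases "a = 0 \<or> b = 0")
    case True
    have "(t / 2) powr r \<le> t powr r / 2" if "t \<ge> 0" for t :: real
      using mult_left_mono[OF half, of "t powr r"] that by (simp add: powr_divide field_simps)
    from this[of a] this[of b] True assms show ?thesis by auto
  next
    case False
    then show ?thesis
      using convex_onD[OF powr_convex[OF assms(3)], of "1/2" a b] assms
      by (simp add: field_simps)
  qed
  then have "(((a + b) / 2) powr r) powr (1 / r) \<le> ((a powr r + b powr r) / 2) powr (1 / r)"
    using assms by (intro powr_mono2) auto
  then show ?thesis using assms by (simp add: powr_powr)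
qed

text \<open>The left side is the energy for exponent 1; the bound holds summand by summand, since a
  maximum or a power mean is at least the arithmetic mean.\<close>

lemma E_energy_ge:
  assumes "1 \<le> p"
  shows "(\<Sum>i\<in>UNIV. (norm (A *v column i P - column i Q)
      + norm (transpose A *v column i Q - column i P)) / 2) \<le> E_energy P Q p A"
proof (cases "p = \<infinity>")
  case True
  then show ?thesis by (auto simp: E_energy_def intro!: sum_mono)
next
  case False
  with assms have "1 \<le> real_of_ereal p" by (cases p) auto
  with False show ?thesis
    by (auto simp: E_energy_def intro!: sum_mono arith_mean_le_power_mean)
qed

lemma norm_transpose_residual:
  fixes R :: "real^'d^'d"
  assumes "orthogonal_matrix R"
  shows "norm (transpose R *v y - x) = norm (R *v x - y)"
proof -
  have "transpose R *v y - x = transpose R *v (y - R *v x)"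
    using assms by (simp add: matrix_vector_mult_diff_distrib matrix_vector_mul_assoc orthogonal_matrix_def)
  moreover have "orthogonal_transformation ((*v) (transpose R))"
    using assms by (simp add: orthogonal_matrix_transpose orthogonal_transformation_matrix)
  ultimately show ?thesis
    by (metis norm_minus_commute orthogonal_transformation_norm)
qed

text \<open>Both residuals of an index have the same norm, so their maximum and all their power
  means equal it, and the energy does not depend on \<open>p\<close>.\<close>

lemma E_energy_orthogonal:
  assumes "orthogonal_matrix R" "1 \<le> p"
  shows "E_energy P Q p R = (\<Sum>i\<in>UNIV. norm (R *v column i P - column i Q))"
proof (cases "p = \<infinity>")
  case True
  then show ?thesis by (simp add: E_energy_def norm_transpose_residual[OF assms(1)] del: transpose_matrix_vector)
next
  case False
  with assms have "1 \<le> real_of_ereal p" by (cases p) auto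
  with False show ?thesis
    by (simp add: E_energy_def norm_transpose_residual[OF assms(1)] powr_powr
          del: transpose_matrix_vector)
qed

lemma E_energy_less:
  fixes P Q :: "real^'n::finite^'d::finite"
  assumes R: "orthogonal_matrix R" and dip: "linear_DIP P Q R I" and p: "1 \<le> p" and "A \<noteq> R"
  shows "E_energy P Q p R < E_energy P Q p A"
proof -
  let ?res = "\<Sum>i\<in>UNIV. norm (R *v column i P - column i Q)"
  have "?res < (\<Sum>i\<in>UNIV. norm (A *v column i P - column i Q))"
    using dip \<open>A \<noteq> R\<close> by (intro sum_norm_residual_less[where I = I]) (auto simp: linear_DIP_def)
  moreover have "?res < (\<Sum>i\<in>UNIV. norm (transpose A *v column i Q - column i P))"
  proof -
    \<comment> \<open>Orthogonality inverts the inlier relation, so the residual bound also applies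
      with \<open>P\<close> and \<open>Q\<close> exchanged and \<open>transpose R\<close> in place
      of \<open>R\<close>, now using the dominance condition on \<open>Q\<close>.\<close>
    have "column i P = transpose R *v column i Q" if "i \<in> I" for i
      using dip R that by (simp add: linear_DIP_def matrix_vector_mul_assoc orthogonal_matrix_def)
    moreover have "transpose A \<noteq> transpose R"
      using \<open>A \<noteq> R\<close> by (metis transpose_transpose)
    ultimately have "(\<Sum>i\<in>UNIV. norm (transpose R *v column i Q - column i P))
        < (\<Sum>i\<in>UNIV. norm (transpose A *v column i Q - column i P))"
      using dip by (intro sum_norm_residual_less[where I = I]) (auto simp: linear_DIP_def)
    then show ?thesis by (simp add: norm_transpose_residual[OF R] del: transpose_matrix_vector)
  qed
  \<comment> \<open>Averaging the two strict bounds gives the exponent 1 case.\<close>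
  ultimately have "?res < (\<Sum>i\<in>UNIV. (norm (A *v column i P - column i Q)
      + norm (transpose A *v column i Q - column i P)) / 2)"
    by (simp add: sum.distrib flip: sum_divide_distrib)
  then show ?thesis
    using E_energy_ge[OF p, of A P Q] by (simp add: E_energy_orthogonal[OF R p])
qed

theorem theorem3p3:
  fixes P Q :: "real^'n::finite^'d::finite"
    and R0 :: "real^'d^'d"
    and I :: "'n set"
    and p :: ereal
  assumes "orthogonal_matrix R0"
    and "linear_DIP P Q R0 I"
    and "1 \<le> p"
  shows "\<forall>A :: real^'d^'d. is_arg_min (E_energy P Q p) (\<lambda>_. True) A \<longleftrightarrow> A = R0"
  unfolding is_arg_min_def using E_energy_less[OF assms] by (metis less_asym)

end
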